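(* Let $G$ be a connected graph of order $n\geq 3$ and let $k$ be an integer such that $1\le k<\Delta(G)$. Suppose there exists a $\gamma(G)$-set $D$ of $G$ such that, for every $u\in D$ with $\deg(u)>k$, there exist at least $\deg(u)-k$ pairwise distinct neighbors $w$ of $u$ with $\deg(w)\le k+1$. Then $$\gamma_k^{\mathrm L}(G)\leq (\Delta(G)-k+1)\,\gamma(G).$$ Moreover, this bound is tight: there exist $G$ and $k$ satisfying all the hypotheses above for which equality holds.
   Context: All graphs are finite, simple and undirected; $\Delta(G)$ is the maximum degree and $N(v)$ is the open neighborhood of $v$. A dominating set of $G$ is a set $D\subseteq V(G)$ such that every vertex not in $D$ has a neighbor in $D$; $\gamma(G)$ is the minimum cardinality of a dominating set, and a $\gamma(G)$-set is a dominating set of cardinality $\gamma(G)$. For an integer $0\le k\le \Delta(G)$, a set $D\subseteq V(G)$ is a $k$-limited dominating set if $D$ is a dominating set and $|N(u)-D|\le k$ for every $u\in D$. $\gamma_k^{\mathrm L}(G)$ is the minimum cardinality of a $k$-limited dominating set of $G$. *)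

theory Defs
  imports "Graph_Theory.Digraph_Component"
begin

text \<open>
  A finite simple undirected graph is a \<^locale>\<open>pair_graph\<close>: finitely many vertices, and an
  irreflexive, symmetric arc relation on them, so each edge is represented by both of its
  orientations.
\<close>

definition nbhd :: "'a pair_pre_digraph \<Rightarrow> 'a \<Rightarrow> 'a set" where
  "nbhd G v = {w. (v, w) \<in> parcs G}"

definition degree :: "'a pair_pre_digraph \<Rightarrow> 'a \<Rightarrow> nat" where
  "degree G v = card (nbhd G v)"

lemma degree_eq_out_degree: "degree G v = out_degree (with_proj G) v"
proof -
  have "out_arcs (with_proj G) v = Pair v ` nbhd G v"
    by (auto simp: nbhd_def)
  then show ?thesis
    by (simp add: degree_def out_degree_def card_image inj_on_def)
qed

definition max_degree :: "'a pair_pre_digraph \<Rightarrow> nat" where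
  "max_degree G = Max (degree G ` pverts G)"

definition dominating_set :: "'a pair_pre_digraph \<Rightarrow> 'a set \<Rightarrow> bool" where
  "dominating_set G D \<longleftrightarrow>
     D \<subseteq> pverts G \<and> (\<forall>v \<in> pverts G - D. nbhd G v \<inter> D \<noteq> {})"

definition domination_number :: "'a pair_pre_digraph \<Rightarrow> nat" where
  "domination_number G = (LEAST m. \<exists>D. dominating_set G D \<and> card D = m)"

definition minimum_dominating_set :: "'a pair_pre_digraph \<Rightarrow> 'a set \<Rightarrow> bool" where
  "minimum_dominating_set G D \<longleftrightarrow> dominating_set G D \<and> card D = domination_number G"

definition limited_dominating_set :: "nat \<Rightarrow> 'a pair_pre_digraph \<Rightarrow> 'a set \<Rightarrow> bool" where
  "limited_dominating_set k G D \<longleftrightarrow>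
     dominating_set G D \<and> (\<forall>u \<in> D. card (nbhd G u - D) \<le> k)"

definition limited_domination_number :: "nat \<Rightarrow> 'a pair_pre_digraph \<Rightarrow> nat" where
  "limited_domination_number k G = (LEAST m. \<exists>D. limited_dominating_set k G D \<and> card D = m)"

end

theory Submission
  imports Defs
begin

text \<open>
  In a dominating set \<open>D\<close>, only the vertices \<open>u\<close> of degree above \<open>k\<close> can have too many neighbours
  outside. Such a \<open>u\<close> is repaired by moving \<open>degree G u - k\<close> of its neighbours into the set, which
  leaves it at most \<open>k\<close> neighbours outside. If the moved neighbours have degree at most \<open>k + 1\<close>, they do
  not need any repair themselves: one of their neighbours, namely \<open>u\<close>, is already inside. Each
  vertex of \<open>D\<close> thus costs at most \<open>max_degree G - k\<close> further vertices
  (\<open>limited_domination_number_le\<close>).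

  The bound is attained by the path on three vertices and \<open>k = 1\<close>: the centre dominates
  alone, but it is the only vertex that does, and it has two neighbours outside,
  so two vertices are needed, and the bound is \<open>(2 - 1 + 1) * 1\<close>.
\<close>

section \<open>The upper bound\<close>

lemma (in pair_fin_digraph) finite_nbhd: "finite (nbhd G v)"
proof -
  have "nbhd G v \<subseteq> pverts G"
    by (auto simp: nbhd_def dest: in_arcsD2)
  then show ?thesis
    using pair_finite_verts finite_subset by blast
qed

lemma (in pair_fin_digraph) degree_le_max_degree:
  "v \<in> pverts G \<Longrightarrow> degree G v \<le> max_degree G"
  unfolding max_degree_def using pair_finite_verts by (intro Max_ge) auto

lemma (in pair_fin_digraph) card_nbhd_Diff:
  assumes "W \<subseteq> nbhd G v"
  shows "card (nbhd G v - W) = degree G v - card W"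
  unfolding degree_def using assms finite_nbhd finite_subset by (intro card_Diff_subset) auto

lemma limited_domination_number_le_card:
  "limited_dominating_set k G D \<Longrightarrow> limited_domination_number k G \<le> card D"
  unfolding limited_domination_number_def by (rule Least_le) blast

text \<open>
  The sets \<open>W u\<close> of neighbours moved for different vertices \<open>u\<close> may overlap, and may meet \<open>D\<close>.
  Such coincidences only make the enlarged set smaller, so the union bound is enough.
\<close>
lemma (in pair_graph) limited_domination_number_le:
  assumes D: "dominating_set G D"
    and low: "\<And>u. u \<in> D \<Longrightarrow> k < degree G u \<Longrightarrow>
      degree G u - k \<le> card {w \<in> nbhd G u. degree G w \<le> k + 1}"
  shows "limited_domination_number k G \<le> (max_degree G - k + 1) * card D"
proof -
  have DV: "D \<subseteq> pverts G"
    using D by (simp add: dominating_set_def)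
  then have finD: "finite D"
    using pair_finite_verts finite_subset by blast
  have "\<exists>W \<subseteq> {w \<in> nbhd G u. degree G w \<le> k + 1}. card W = degree G u - k" if "u \<in> D" for u
  proof (cases "k < degree G u")
    case True
    then show ?thesis
      using low[OF that True] by (meson obtain_subset_with_card_n)
  qed (auto intro: exI[of _ "{}"])
  then obtain W where
    W: "\<And>u. u \<in> D \<Longrightarrow> W u \<subseteq> {w \<in> nbhd G u. degree G w \<le> k + 1}"
    and cardW: "\<And>u. u \<in> D \<Longrightarrow> card (W u) = degree G u - k"
    by metis
  define E where "E = D \<union> (\<Union>u\<in>D. W u)"
  have "dominating_set G E"
    unfolding dominating_set_def
  proof (intro conjI ballI)
    show "E \<subseteq> pverts G"
      using W DV by (fastforce simp: E_def nbhd_def dest: in_arcsD2)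
    show "nbhd G v \<inter> E \<noteq> {}" if "v \<in> pverts G - E" for v
      using D that by (auto simp: dominating_set_def E_def)
  qed
  moreover have "card (nbhd G x - E) \<le> k" if x: "x \<in> E" for x
  proof -
    \<comment> \<open>A vertex of \<open>D\<close> is relieved by the neighbours moved for it, a moved vertex by the vertex of
      \<open>D\<close> for which it was moved.\<close>
    have "\<exists>S \<subseteq> nbhd G x \<inter> E. degree G x - card S \<le> k"
    proof (cases "x \<in> D")
      case True
      then show ?thesis
        using W[OF True] cardW[OF True] by (intro exI[of _ "W x"]) (auto simp: E_def)
    next
      case False
      then obtain u where u: "u \<in> D" "x \<in> W u"
        using x by (auto simp: E_def)
      then have "(u, x) \<in> parcs G" "degree G x \<le> k + 1"
        using W[of u] by (auto simp: nbhd_def)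
      moreover from this have "(x, u) \<in> parcs G"
        using pair_sym_arcs by (auto simp: symmetric_def elim: symE)
      ultimately show ?thesis
        using u by (intro exI[of _ "{u}"]) (auto simp: nbhd_def E_def)
    qed
    then obtain S where S: "S \<subseteq> nbhd G x" "S \<subseteq> E" "degree G x - card S \<le> k"
      by auto
    have "card (nbhd G x - E) \<le> card (nbhd G x - S)"
      using S finite_nbhd by (intro card_mono) auto
    then show ?thesis
      using S card_nbhd_Diff[of S x] by simp
  qed
  ultimately have "limited_domination_number k G \<le> card E"
    by (intro limited_domination_number_le_card) (simp add: limited_dominating_set_def)
  also have "\<dots> \<le> card D + card (\<Union>u\<in>D. W u)"
    unfolding E_def by (rule card_Un_le)
  also have "card (\<Union>u\<in>D. W u) \<le> (\<Sum>u\<in>D. card (W u))"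
    using finD by (rule card_UN_le)
  also have "\<dots> \<le> (\<Sum>u\<in>D. max_degree G - k)"
    using DV degree_le_max_degree by (intro sum_mono) (auto simp: cardW intro: diff_le_mono)
  finally show ?thesis
    by (simp add: algebra_simps)
qed

section \<open>Tightness\<close>

definition three_vertex_path :: "nat pair_pre_digraph" where
  "three_vertex_path = \<lparr>pverts = {0, 1, 2}, parcs = {(0, 1), (1, 0), (0, 2), (2, 0)}\<rparr>"

lemma pair_graph_three_vertex_path: "pair_graph three_vertex_path"
  by unfold_locales (auto simp: three_vertex_path_def symmetric_def sym_def)

interpretation three_vertex_path: pair_graph three_vertex_path
  by (rule pair_graph_three_vertex_path)

lemma connected_three_vertex_path: "connected (with_proj three_vertex_path)"
proof -
  let ?G = three_vertex_path
  have "v = 0 \<or> (0, v) \<in> parcs ?G \<and> (v, 0) \<in> parcs ?G" if "v \<in> pverts ?G" for v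
    using that by (auto simp: three_vertex_path_def)
  moreover have "0 \<in> pverts ?G"
    by (simp add: three_vertex_path_def)
  ultimately have to_verts: "0 \<rightarrow>\<^sup>*\<^bsub>with_proj ?G\<^esub> v"
    and from_verts: "v \<rightarrow>\<^sup>*\<^bsub>with_proj ?G\<^esub> 0" if "v \<in> pverts ?G" for v
    using that three_vertex_path.reachable_refl three_vertex_path.reachable_adjI by metis+
  have "u \<rightarrow>\<^sup>*\<^bsub>with_proj ?G\<^esub> v" if "u \<in> pverts ?G" "v \<in> pverts ?G" for u v
    using three_vertex_path.reachable_trans[OF from_verts[OF that(1)] to_verts[OF that(2)]] .
  then show ?thesis
    unfolding connected_def
    by (intro strongly_connectedI three_vertex_path.reachable_mk_symmetricI)
      (simp_all add: three_vertex_path_def)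
qed

lemma nbhd_three_vertex_path:
  "nbhd three_vertex_path 0 = {1, 2}"
  "nbhd three_vertex_path (Suc 0) = {0}"
  "nbhd three_vertex_path 2 = {0}"
  by (auto simp: nbhd_def three_vertex_path_def)

lemma degree_three_vertex_path:
  "degree three_vertex_path 0 = 2"
  "degree three_vertex_path (Suc 0) = 1"
  "degree three_vertex_path 2 = 1"
  by (simp_all add: degree_def nbhd_three_vertex_path)

lemma max_degree_three_vertex_path: "max_degree three_vertex_path = 2"
proof -
  have "pverts three_vertex_path = {0, 1, 2}"
    by (simp add: three_vertex_path_def)
  then show ?thesis
    by (simp add: max_degree_def degree_three_vertex_path)
qed

lemma dominating_set_three_vertex_path_centre: "dominating_set three_vertex_path {0}"
  by (auto simp: dominating_set_def nbhd_def three_vertex_path_def)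

lemma dominating_set_three_vertex_path_singletonD:
  assumes "dominating_set three_vertex_path {v}"
  shows "v = 0"
proof (rule ccontr)
  assume "v \<noteq> 0"
  then have "v = 1 \<or> v = 2"
    using assms by (simp add: dominating_set_def three_vertex_path_def)
  \<comment> \<open>The other leaf is not dominated by \<open>v\<close>.\<close>
  moreover have "3 - v \<in> pverts three_vertex_path - {v}"
    and "nbhd three_vertex_path (3 - v) \<inter> {v} = {}"
    using calculation
    by (elim disjE; simp add: three_vertex_path_def nbhd_def numeral_eq_Suc)+
  ultimately show False
    using assms unfolding dominating_set_def by blast
qed

lemma card_dominating_set_three_vertex_path:
  assumes "dominating_set three_vertex_path D"
  shows "1 \<le> card D"
proof -
  have "D \<noteq> {}" and sub: "D \<subseteq> {0, 1, 2}"
    using assms by (auto simp: dominating_set_def three_vertex_path_def)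
  moreover have "finite D"
    by (rule finite_subset[OF sub]) simp
  ultimately have "0 < card D"
    by (simp add: card_gt_0_iff)
  then show ?thesis
    by simp
qed

lemma domination_number_three_vertex_path: "domination_number three_vertex_path = 1"
  unfolding domination_number_def
proof (rule Least_equality)
  show "\<exists>D. dominating_set three_vertex_path D \<and> card D = 1"
    using dominating_set_three_vertex_path_centre by (intro exI[of _ "{0}"]) simp
qed (use card_dominating_set_three_vertex_path in blast)

lemma limited_domination_number_three_vertex_path:
  "limited_domination_number 1 three_vertex_path = 2"
  unfolding limited_domination_number_def
proof (rule Least_equality)
  have "limited_dominating_set 1 three_vertex_path {0, 1}"
    unfolding limited_dominating_set_def
  proof (intro conjI ballI)
    show "dominating_set three_vertex_path {0, 1}"
      by (auto simp: dominating_set_def three_vertex_path_def nbhd_def)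
    show "card (nbhd three_vertex_path u - {0, 1}) \<le> 1" if "u \<in> {0, 1}" for u
      using that by (elim insertE emptyE; simp add: nbhd_three_vertex_path insert_Diff_if)
  qed
  then show "\<exists>D. limited_dominating_set 1 three_vertex_path D \<and> card D = 2"
    by (intro exI[of _ "{0, 1}"]) simp
next
  fix m assume "\<exists>D. limited_dominating_set 1 three_vertex_path D \<and> card D = m"
  then obtain D where D: "limited_dominating_set 1 three_vertex_path D" "card D = m"
    by blast
  have "card D \<noteq> 1"
  proof
    assume "card D = 1"
    then obtain v where v: "D = {v}"
      by (rule card_1_singletonE)
    with D(1) have "v = 0"
      using dominating_set_three_vertex_path_singletonD by (simp add: limited_dominating_set_def)
    with D(1) v show False
      by (simp add: limited_dominating_set_def nbhd_three_vertex_path)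
  qed
  then show "2 \<le> m"
    using card_dominating_set_three_vertex_path[of D] D by (simp add: limited_dominating_set_def)
qed

theorem proposition6:
  shows "(\<forall>(G :: 'a pair_pre_digraph) (k :: nat).
            pair_graph G \<and> connected (with_proj G) \<and> card (pverts G) \<ge> 3 \<and>
            1 \<le> k \<and> k < max_degree G \<and>
            (\<exists>D. minimum_dominating_set G D \<and>
               (\<forall>u \<in> D. degree G u > k \<longrightarrow>
                  card {w \<in> nbhd G u. degree G w \<le> k + 1} \<ge> degree G u - k))
            \<longrightarrow> limited_domination_number k G \<le> (max_degree G - k + 1) * domination_number G)
       \<and> (\<exists>(G :: nat pair_pre_digraph) (k :: nat).
            pair_graph G \<and> connected (with_proj G) \<and> card (pverts G) \<ge> 3 \<and>
            1 \<le> k \<and> k < max_degree G \<and>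
            (\<exists>D. minimum_dominating_set G D \<and>
               (\<forall>u \<in> D. degree G u > k \<longrightarrow>
                  card {w \<in> nbhd G u. degree G w \<le> k + 1} \<ge> degree G u - k)) \<and>
            limited_domination_number k G = (max_degree G - k + 1) * domination_number G)"
    (is "?bound \<and> ?tight")
proof
  show ?bound
  proof (intro allI impI, elim conjE exE)
    fix G :: "'a pair_pre_digraph" and k D
    assume G: "pair_graph G" and D: "minimum_dominating_set G D"
      and low: "\<forall>u \<in> D. degree G u > k \<longrightarrow>
        card {w \<in> nbhd G u. degree G w \<le> k + 1} \<ge> degree G u - k"
    have "limited_domination_number k G \<le> (max_degree G - k + 1) * card D"
      using D low by (intro pair_graph.limited_domination_number_le[OF G])
        (simp_all add: minimum_dominating_set_def)
    then show "limited_domination_number k G \<le> (max_degree G - k + 1) * domination_number G"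
      using D by (simp add: minimum_dominating_set_def)
  qed
next
  let ?G = three_vertex_path
  have "minimum_dominating_set ?G {0}"
    by (simp add: minimum_dominating_set_def dominating_set_three_vertex_path_centre
        domination_number_three_vertex_path)
  moreover have "{w \<in> nbhd ?G 0. degree ?G w \<le> 1 + 1} = {1, 2}"
    by (auto simp: nbhd_three_vertex_path degree_three_vertex_path)
  ultimately have "\<exists>D. minimum_dominating_set ?G D \<and>
      (\<forall>u \<in> D. degree ?G u > 1 \<longrightarrow>
        card {w \<in> nbhd ?G u. degree ?G w \<le> 1 + 1} \<ge> degree ?G u - 1)"
    by (intro exI[of _ "{0}"]) (simp add: degree_three_vertex_path)
  moreover have "card (pverts ?G) = 3"
    by (simp add: three_vertex_path_def)
  moreover have "1 < max_degree ?G"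
    by (simp add: max_degree_three_vertex_path)
  moreover have "limited_domination_number 1 ?G = (max_degree ?G - 1 + 1) * domination_number ?G"
    unfolding max_degree_three_vertex_path domination_number_three_vertex_path
      limited_domination_number_three_vertex_path by simp
  ultimately show ?tight
    using pair_graph_three_vertex_path connected_three_vertex_path
    by (intro exI[of _ ?G] exI[of _ 1] conjI) (simp_all only: order_refl)
qed

end
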